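(* Let $r\ge 1$ and let $f_r$ be the function $$f_r(X^1,\ldots,X^K,Q)=\ell(\Phi_r(X^1,\ldots,X^K),Q)+\lambda\sum_{i=1}^r g(X^1_i,\ldots,X^K_i)+H(Q),$$ with $\phi,\Phi_r,g,\ell,H,\lambda$ satisfying the definitions and assumptions listed in the context. Then any local minimizer $(X^1,\ldots,X^K,Q)$ of the optimization problem $$\min_{(X^1,\ldots,X^K)_r,\,Q}\ f_r(X^1,\ldots,X^K,Q)$$ such that $(X^1_{i_0},\ldots,X^K_{i_0})=(0,\ldots,0)$ for some $i_0\in\{1,\ldots,r\}$ is a global minimizer of this problem.
   Context: Tensor notation: $D, D^1,\ldots,D^K$ are multi-indices of dimensions; for $D=d_1\times\cdots\times d_N$, $\mathbb{R}^D=\mathbb{R}^{d_1\times\cdots\times d_N}$. The inner product $\langle\cdot,\cdot\rangle$ is the standard dot product of the flattened tensors. A size-$r$ set of $K$ factors $(X^1,\ldots,X^K)_r$ is an element of $\mathbb{R}^{D^1\times r}\times\cdots\times\mathbb{R}^{D^K\times r}$; $X^k_i\in\mathbb{R}^{D^k}$ is the $i$-th slice of $X^k$ along its last dimension. A function $\theta$ of several tensor arguments is positively homogeneous with degree $p$ if $\theta(\alpha x^1,\ldots,\alpha x^N)=\alpha^p\theta(x^1,\ldots,x^N)$ for all $\alpha\ge 0$ (in particular it vanishes at $0$ when $p\neq0$). It is positive semidefinite if it vanishes at $(0,\ldots,0)$ and is nonnegative everywhere. Elemental mapping: $\phi:\mathbb{R}^{D^1}\times\cdots\times\mathbb{R}^{D^K}\to\mathbb{R}^D$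 is any mapping that is positively homogeneous with some degree $p\neq 0$. The $r$-element factorization mapping is $\Phi_r(X^1,\ldots,X^K)=\sum_{i=1}^r\phi(X^1_i,\ldots,X^K_i)$. Elemental regularization function: $g:\mathbb{R}^{D^1}\times\cdots\times\mathbb{R}^{D^K}\to\mathbb{R}_+\cup\{\infty\}$ is any positive semidefinite, positively homogeneous function. $(\phi,g)$ is a nondegenerate pair if (1) $g$ and $\phi$ are both positively homogeneous with the same degree $p$, for some $p\ne0$, and (2) for every $X\in\mathrm{Im}(\phi)\setminus\{0\}$ there exist $\mu\in(0,\infty]$ and $(\tilde z^1,\ldots,\tilde z^K)$ such that $\phi(\tilde z^1,\ldots,\tilde z^K)=X$, $g(\tilde z^1,\ldots,\tilde z^K)=\mu$, and $g(z^1,\ldots,z^K)\ge\mu$ for all $(z^1,\ldots,z^K)$ with $\phi(z^1,\ldots,z^K)=X$. Factorization regularization function: for $X\in\mathbb{R}^D$, $$\Omega_{\phi,g}(X)=\inf_{r\in\mathbb{N}_+}\ \inf_{(X^1,\ldots,X^K)_r}\Big\{\sum_{i=1}^r g(X^1_i,\ldots,X^K_i)\ :\ \Phi_r(X^1,\ldots,X^K)=X\Big\},$$ with $\Omega_{\phi,g}(X)=\infty$ if $X\notin\bigcup_r\mathrm{Im}(\Phi_r)$. Standing assumptions: $Q$ ranges over a finite-dimensional real vector space $E$ (additional non-factorized variables); $\ell:\mathbb{R}^D\times E\to\mathbb{R}$ is once differentiable and jointly convex in $(X,Q)$; $H:E\to\mathbb{R}$ is convex (possibly non-differentiable); $(\phi,g)$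 is a nondegenerate pair; $\lambda>0$; and the convex function $F(X,Q)=\ell(X,Q)+\lambda\Omega_{\phi,g}(X)+H(Q)$ attains its minimum over $\mathbb{R}^D\times E$. *)

theory Defs
  imports "HOL-Analysis.Analysis"
begin

text \<open>
  The factor spaces have shapes that vary with \<open>k\<close> and with \<open>r\<close>, so their tensors cannot be indexed
  by types. A tensor of shape \<open>D = [d\<^sub>1, \<dots>, d\<^sub>N]\<close> is a function on multi-indices (0-based) that
  vanishes off \<open>{0..<d\<^sub>1} \<times> \<dots> \<times> {0..<d\<^sub>N}\<close>; a tuple \<open>(x\<^sup>1, \<dots>, x\<^sup>K)\<close> is a function of \<open>k < K\<close>,
  extended by zero. The library's product topology on functions induces the Euclidean topology on
  these spaces.
\<close>

type_synonym tensor = "nat list \<Rightarrow> real"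
type_synonym tensor_tuple = "nat \<Rightarrow> tensor"

definition tensor_space :: "nat list \<Rightarrow> tensor set" where
  "tensor_space D = {x. \<forall>js. \<not> list_all2 (<) js D \<longrightarrow> x js = 0}"

definition tuple_space :: "nat list list \<Rightarrow> tensor_tuple set" where
  "tuple_space Ds =
     {x. (\<forall>k < length Ds. x k \<in> tensor_space (Ds ! k)) \<and> (\<forall>k \<ge> length Ds. x k = (\<lambda>_. 0))}"

definition zero_tuple :: tensor_tuple where
  "zero_tuple = (\<lambda>k js. 0)"

definition scale_tuple :: "real \<Rightarrow> tensor_tuple \<Rightarrow> tensor_tuple" where
  "scale_tuple a x = (\<lambda>k js. a * x k js)"

definition factor_space :: "nat list list \<Rightarrow> nat \<Rightarrow> tensor_tuple set" where
  "factor_space Ds r = tuple_space (map (\<lambda>D. D @ [r]) Ds)"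

definition slice :: "nat \<Rightarrow> tensor_tuple \<Rightarrow> tensor_tuple" where
  "slice i X = (\<lambda>k js. X k (js @ [i]))"

text \<open>
  The defining identity is required at \<open>\<alpha> = 0\<close> as well, so \<open>\<alpha>\<^sup>p\<close> has to make sense there; this
  excludes negative degrees. Since \<open>0 powr 0 = 0\<close>, the convention \<open>0\<^sup>0 = 1\<close> is spelled out.
  The scalar action on the codomain is a parameter because it is used both for a real vector
  space and for the extended reals (where \<open>0 * \<infinity> = 0\<close>).
\<close>

definition pos_homogeneous ::
    "(real \<Rightarrow> 'b \<Rightarrow> 'b) \<Rightarrow> nat list list \<Rightarrow> real \<Rightarrow> (tensor_tuple \<Rightarrow> 'b) \<Rightarrow> bool" where
  "pos_homogeneous act Ds p \<theta> \<longleftrightarrow>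
     0 \<le> p \<and>
     (\<forall>\<alpha> \<ge> 0. \<forall>x \<in> tuple_space Ds.
        \<theta> (scale_tuple \<alpha> x) = act (if p = 0 then 1 else \<alpha> powr p) (\<theta> x))"

definition pos_semidefinite :: "nat list list \<Rightarrow> (tensor_tuple \<Rightarrow> ereal) \<Rightarrow> bool" where
  "pos_semidefinite Ds \<theta> \<longleftrightarrow> \<theta> zero_tuple = 0 \<and> (\<forall>x \<in> tuple_space Ds. 0 \<le> \<theta> x)"

definition elemental_mapping :: "nat list list \<Rightarrow> (tensor_tuple \<Rightarrow> real ^ 'd) \<Rightarrow> bool" where
  "elemental_mapping Ds \<phi> \<longleftrightarrow> (\<exists>p. p \<noteq> 0 \<and> pos_homogeneous (*\<^sub>R) Ds p \<phi>)"

definition elemental_regularizer :: "nat list list \<Rightarrow> (tensor_tuple \<Rightarrow> ereal) \<Rightarrow> bool" where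
  "elemental_regularizer Ds g \<longleftrightarrow>
     pos_semidefinite Ds g \<and> (\<exists>p. pos_homogeneous (\<lambda>a y. ereal a * y) Ds p g)"

definition nondegenerate_pair ::
    "nat list list \<Rightarrow> (tensor_tuple \<Rightarrow> real ^ 'd) \<Rightarrow> (tensor_tuple \<Rightarrow> ereal) \<Rightarrow> bool" where
  "nondegenerate_pair Ds \<phi> g \<longleftrightarrow>
     (\<exists>p. p \<noteq> 0 \<and> pos_homogeneous (\<lambda>a y. ereal a * y) Ds p g \<and> pos_homogeneous (*\<^sub>R) Ds p \<phi>) \<and>
     (\<forall>X \<in> \<phi> ` tuple_space Ds - {0}.
        \<exists>\<mu> > 0. \<exists>z \<in> tuple_space Ds. \<phi> z = X \<and> g z = \<mu> \<and>
          (\<forall>z' \<in> tuple_space Ds. \<phi> z' = X \<longrightarrow> g z' \<ge> \<mu>))"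

definition factorization_map ::
    "(tensor_tuple \<Rightarrow> real ^ 'd) \<Rightarrow> nat \<Rightarrow> tensor_tuple \<Rightarrow> real ^ 'd" where
  "factorization_map \<phi> r X = (\<Sum>i<r. \<phi> (slice i X))"

text \<open>The infimum of the empty set in \<^typ>\<open>ereal\<close> is \<open>\<infinity>\<close>.\<close>

definition factorization_regularizer ::
    "nat list list \<Rightarrow> (tensor_tuple \<Rightarrow> real ^ 'd) \<Rightarrow> (tensor_tuple \<Rightarrow> ereal) \<Rightarrow> real ^ 'd \<Rightarrow> ereal"
  where
  "factorization_regularizer Ds \<phi> g X =
     (INF r \<in> {1..}. INF Z \<in> {Z \<in> factor_space Ds r. factorization_map \<phi> r Z = X}.
        \<Sum>i<r. g (slice i Z))"

definition convex_objective ::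
    "nat list list \<Rightarrow> (tensor_tuple \<Rightarrow> real ^ 'd) \<Rightarrow> (tensor_tuple \<Rightarrow> ereal) \<Rightarrow>
     ((real ^ 'd) \<times> 'e \<Rightarrow> real) \<Rightarrow> ('e \<Rightarrow> real) \<Rightarrow> real \<Rightarrow> (real ^ 'd) \<times> 'e \<Rightarrow> ereal" where
  "convex_objective Ds \<phi> g l H c =
     (\<lambda>(X, Q). ereal (l (X, Q)) + ereal c * factorization_regularizer Ds \<phi> g X + ereal (H Q))"

definition factorized_objective ::
    "(tensor_tuple \<Rightarrow> real ^ 'd) \<Rightarrow> (tensor_tuple \<Rightarrow> ereal) \<Rightarrow>
     ((real ^ 'd) \<times> 'e \<Rightarrow> real) \<Rightarrow> ('e \<Rightarrow> real) \<Rightarrow> real \<Rightarrow> nat \<Rightarrow> tensor_tuple \<times> 'e \<Rightarrow> ereal" where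
  "factorized_objective \<phi> g l H c r =
     (\<lambda>(X, Q). ereal (l (factorization_map \<phi> r X, Q)) + ereal c * (\<Sum>i<r. g (slice i X))
        + ereal (H Q))"

text \<open>
  As usual for extended-real-valued objectives, a minimizer lies in the effective domain. Without
  this, every interior point of \<open>{f = \<infinity>}\<close> would count as a local minimizer.
\<close>

definition global_minimizer :: "('a \<Rightarrow> ereal) \<Rightarrow> 'a set \<Rightarrow> 'a \<Rightarrow> bool" where
  "global_minimizer f S x \<longleftrightarrow> x \<in> S \<and> f x < \<infinity> \<and> (\<forall>y \<in> S. f x \<le> f y)"

definition local_minimizer :: "('a::topological_space \<Rightarrow> ereal) \<Rightarrow> 'a set \<Rightarrow> 'a \<Rightarrow> bool" where
  "local_minimizer f S x \<longleftrightarrow>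
     x \<in> S \<and> f x < \<infinity> \<and> (\<forall>\<^sub>F y in at x within S. f x \<le> f y)"

end

theory Submission
  imports Defs
begin

text \<open>
  The objective is convex in the pair (product, variable \<open>Q\<close>) but not in the factors. The idea is
  that a zero slice makes room for a convex-combination path in factor space itself. Let \<open>p\<close> be the
  common degree of \<open>\<phi>\<close> and \<open>g\<close>. Multiplying a slice by \<open>s\<close> to the power \<open>1 / p\<close> multiplies both its
  contribution to the product and its contribution to the regularizer by \<open>s\<close>. Hence, shrinking
  every slice with \<open>s = 1 - t\<close> and placing a new atom \<open>z\<close> with \<open>s = t\<close> in the empty slot moves the
  pair (product \<open>Y\<close>, regularizer \<open>G\<close>) along the segment from \<open>(Y, G)\<close> to \<open>(\<phi> z, g z)\<close>, while the
  factors move continuously away from the given local minimizer (\<open>perturbed_slices\<close>,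
  \<open>continuous_on_perturbation\<close>).

  Local minimality along these paths gives, with \<open>L\<close> the derivative of \<open>l\<close> at \<open>(Y, Q)\<close>,
  \<open>0 \<le> L (\<phi> z - Y, Q' - Q) + c (g z - G) + H Q' - H Q\<close> for all \<open>z\<close> and \<open>Q'\<close>
  (\<open>single_atom_optimality\<close>). A competitor with \<open>r\<close> slices \<open>z\<^sub>j\<close> is the average of the single atoms
  obtained by enlarging \<open>z\<^sub>j\<close> so that its contributions are multiplied by \<open>r\<close>. As \<open>L\<close> is linear,
  averaging the inequalities yields the same inequality for the competitor's product and
  regularizer, and the gradient inequality of the convex function \<open>l\<close> turns it into global
  optimality.
\<close>

section \<open>First-order conditions\<close>

lemma directional_derivative_lower_bound:
  fixes h :: "'a::real_normed_vector \<Rightarrow> real"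
  assumes deriv: "(h has_derivative L) (at a)"
    and ev: "\<forall>\<^sub>F t in at_right 0. 0 \<le> h (a + t *\<^sub>R d) - h a + t * k"
  shows "0 \<le> L d + k"
proof -
  have "((\<lambda>t::real. a + t *\<^sub>R d) has_derivative (\<lambda>t. t *\<^sub>R d)) (at 0)"
    by (auto intro!: derivative_eq_intros)
  then have "((\<lambda>t::real. h (a + t *\<^sub>R d)) has_derivative (\<lambda>t. L (t *\<^sub>R d))) (at 0)"
    by (rule has_derivative_compose) (use deriv in simp)
  moreover have "(\<lambda>t. L (t *\<^sub>R d)) = (*) (L d)"
    using linear_scale[OF has_derivative_linear[OF deriv]] by (auto simp: fun_eq_iff)
  ultimately have "((\<lambda>t::real. h (a + t *\<^sub>R d)) has_field_derivative L d) (at 0)"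
    by (simp add: has_field_derivative_def)
  then have "(\<lambda>t. (h (a + t *\<^sub>R d) - h a) / t) \<midarrow>0\<rightarrow> L d"
    by (simp add: DERIV_def)
  then have "((\<lambda>t. (h (a + t *\<^sub>R d) - h a) / t) \<longlongrightarrow> L d) (at_right 0)"
    by (rule filterlim_mono[OF _ order_refl at_le]) simp
  then have "((\<lambda>t. (h (a + t *\<^sub>R d) - h a) / t + k) \<longlongrightarrow> L d + k) (at_right 0)"
    by (intro tendsto_intros)
  moreover have "\<forall>\<^sub>F t in at_right (0::real). 0 \<le> (h (a + t *\<^sub>R d) - h a) / t + k"
    using ev eventually_at_right_less[of 0]
  proof eventually_elim
    case (elim t)
    have "(h (a + t *\<^sub>R d) - h a) / t + k = (h (a + t *\<^sub>R d) - h a + t * k) / t"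
      using elim by (simp add: field_simps)
    then show ?case using elim by simp
  qed
  ultimately show ?thesis
    by (rule tendsto_lowerbound) simp
qed

lemma eventually_at_right_0_less_1: "\<forall>\<^sub>F t in at_right (0::real). 0 < t \<and> t < 1"
  by (rule eventually_at_rightI[of 0 1]) auto

text \<open>
  Convexity bounds the increment of \<open>h\<close> along the segment by a linear function, so this is the
  previous lemma for \<open>- h\<close>.
\<close>

lemma convex_gradient_inequality:
  fixes h :: "'a::real_normed_vector \<Rightarrow> real"
  assumes conv: "convex_on UNIV h" and deriv: "(h has_derivative L) (at a)"
  shows "h a + L (b - a) \<le> h b"
proof -
  have "\<forall>\<^sub>F t in at_right 0. 0 \<le> - h (a + t *\<^sub>R (b - a)) - - h a + t * (h b - h a)"
    using eventually_at_right_0_less_1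
  proof eventually_elim
    case (elim t)
    have "h ((1 - t) *\<^sub>R a + t *\<^sub>R b) \<le> (1 - t) * h a + t * h b"
      using elim by (intro convex_onD[OF conv]) auto
    moreover have "(1 - t) *\<^sub>R a + t *\<^sub>R b = a + t *\<^sub>R (b - a)"
      by (simp add: algebra_simps)
    ultimately show ?case by (simp add: algebra_simps)
  qed
  from directional_derivative_lower_bound[OF has_derivative_minus[OF deriv] this]
  show ?thesis by simp
qed

section \<open>Assembling factors from slices\<close>

definition stack :: "nat \<Rightarrow> (nat \<Rightarrow> tensor_tuple) \<Rightarrow> tensor_tuple" where
  "stack r xs = (\<lambda>k js. if js \<noteq> [] \<and> last js < r then xs (last js) k (butlast js) else 0)"

lemma slice_stack: "i < r \<Longrightarrow> slice i (stack r xs) = xs i"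
  by (simp add: slice_def stack_def)

lemma list_all2_less_snocE:
  assumes "list_all2 (<) js (D @ [r :: nat])"
  obtains js' i where "js = js' @ [i]" "list_all2 (<) js' D" "i < r"
  using assms by (auto simp: list_all2_append2 list_all2_Cons2)

lemma stack_in_factor_space:
  assumes "\<And>i. i < r \<Longrightarrow> xs i \<in> tuple_space Ds"
  shows "stack r xs \<in> factor_space Ds r"
proof -
  have "stack r xs k js = 0"
    if k: "k < length Ds" and js: "\<not> list_all2 (<) js (Ds ! k @ [r])" for k js
  proof (cases "js \<noteq> [] \<and> last js < r")
    case True
    then have "\<not> list_all2 (<) (butlast js) (Ds ! k)"
      using js by (metis append_butlast_last_id list_all2_appendI list.rel_inject)
    then show ?thesis
      using True k assms[of "last js"] by (auto simp: stack_def tuple_space_def tensor_space_def)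
  qed (auto simp: stack_def)
  moreover have "stack r xs k = (\<lambda>_. 0)" if "k \<ge> length Ds" for k
    using that assms by (auto simp: stack_def tuple_space_def fun_eq_iff)
  ultimately show ?thesis
    by (auto simp: factor_space_def tuple_space_def tensor_space_def)
qed

lemma slice_in_tuple_space:
  assumes "X \<in> factor_space Ds r"
  shows "slice i X \<in> tuple_space Ds"
proof -
  have "\<not> list_all2 (<) (js @ [i]) (D @ [r])" if "\<not> list_all2 (<) js D" for js D
    using that by (auto elim!: list_all2_less_snocE)
  then show ?thesis
    using assms by (auto simp: slice_def factor_space_def tuple_space_def tensor_space_def)
qed

lemma stack_slices:
  assumes "X \<in> factor_space Ds r"
  shows "stack r (\<lambda>i. slice i X) = X"
proof (intro ext)
  fix k js
  have "X k js = 0" if "\<not> (js \<noteq> [] \<and> last js < r)"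
  proof (cases "k < length Ds")
    case True
    have "\<not> list_all2 (<) js (Ds ! k @ [r])"
      using that by (auto elim!: list_all2_less_snocE)
    then show ?thesis
      using True assms by (auto simp: factor_space_def tuple_space_def tensor_space_def)
  next
    case False
    then show ?thesis using assms by (auto simp: factor_space_def tuple_space_def)
  qed
  then show "stack r (\<lambda>i. slice i X) k js = X k js"
    by (auto simp: stack_def slice_def)
qed

lemma scale_tuple_in_tuple_space: "x \<in> tuple_space Ds \<Longrightarrow> scale_tuple a x \<in> tuple_space Ds"
  by (auto simp: scale_tuple_def tuple_space_def tensor_space_def)

section \<open>Homogeneity along the perturbation\<close>

lemma pos_homogeneous_root_scale:
  assumes "pos_homogeneous act Ds p \<theta>" "0 < p" "x \<in> tuple_space Ds" "0 \<le> a"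
  shows "\<theta> (scale_tuple (a powr (1 / p)) x) = act a (\<theta> x)"
  using assms by (auto simp: pos_homogeneous_def powr_powr)

lemma zero_tuple_in_tuple_space: "zero_tuple \<in> tuple_space Ds"
  by (auto simp: zero_tuple_def tuple_space_def tensor_space_def)

text \<open>
  The root of the weight cancels the degree of homogeneity, so that the contributions of the slices
  are linear in \<open>t\<close>. When \<open>p > 1\<close> a nonzero new slice has infinite initial speed; this
  is harmless, since local minimality only asks the path to be continuous.
\<close>

definition perturbation ::
    "real \<Rightarrow> nat \<Rightarrow> tensor_tuple \<Rightarrow> nat \<Rightarrow> tensor_tuple \<Rightarrow> real \<Rightarrow> tensor_tuple" where
  "perturbation p r X i0 z t =
     stack r (\<lambda>i. if i = i0 then scale_tuple (t powr (1 / p)) z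
                  else scale_tuple ((1 - t) powr (1 / p)) (slice i X))"

lemma perturbation_in_factor_space:
  assumes "X \<in> factor_space Ds r" "z \<in> tuple_space Ds"
  shows "perturbation p r X i0 z t \<in> factor_space Ds r"
  unfolding perturbation_def
  using assms by (intro stack_in_factor_space)
    (auto intro: scale_tuple_in_tuple_space slice_in_tuple_space)

lemma perturbation_0:
  assumes X: "X \<in> factor_space Ds r" and zero: "slice i0 X = zero_tuple"
  shows "perturbation p r X i0 z 0 = X"
proof -
  have "(\<lambda>i. if i = i0 then scale_tuple (0 powr (1 / p)) z
             else scale_tuple ((1 - 0) powr (1 / p)) (slice i X)) = (\<lambda>i. slice i X)"
    by (auto simp: zero zero_tuple_def scale_tuple_def)
  then show ?thesis
    unfolding perturbation_def using stack_slices[OF X] by simp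
qed

lemma continuous_on_perturbation:
  assumes "0 < p"
  shows "continuous_on {0..1} (perturbation p r X i0 z)"
proof (intro continuous_on_coordinatewise_then_product)
  fix k js
  have "continuous_on {0..1} (\<lambda>t::real. t powr (1 / p) * b)"
    "continuous_on {0..1} (\<lambda>t::real. (1 - t) powr (1 / p) * b)" for b
    using assms by (auto intro!: continuous_intros continuous_on_powr')
  then show "continuous_on {0..1} (\<lambda>t. perturbation p r X i0 z t k js)"
    unfolding perturbation_def stack_def scale_tuple_def
    by (cases "js \<noteq> [] \<and> last js < r"; cases "last js = i0") auto
qed

lemma perturbed_slices:
  assumes hom: "pos_homogeneous act Ds p \<theta>" and p: "0 < p"
    and X: "X \<in> factor_space Ds r" and z: "z \<in> tuple_space Ds"
    and i: "i < r" and t: "0 \<le> t" "t \<le> 1"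
  shows "\<theta> (slice i (perturbation p r X i0 z t)) =
    (if i = i0 then act t (\<theta> z) else act (1 - t) (\<theta> (slice i X)))"
  using pos_homogeneous_root_scale[OF hom p z t(1)]
    pos_homogeneous_root_scale[OF hom p slice_in_tuple_space[OF X], of "1 - t" i] t i
  by (simp add: perturbation_def slice_stack)

text \<open>
  Since the old entry in slot \<open>i0\<close> is zero, it can be given the weight \<open>1 - t\<close> as well; this is
  where the zero slice makes the sum move along a segment.
\<close>

lemma sum_one_slot_replaced:
  fixes a :: "nat \<Rightarrow> 'b::real_vector"
  assumes "i0 < r" "a i0 = 0"
  shows "(\<Sum>i<r. if i = i0 then t *\<^sub>R b else (1 - t) *\<^sub>R a i) = (1 - t) *\<^sub>R (\<Sum>i<r. a i) + t *\<^sub>R b"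
proof -
  have "(\<Sum>i<r. if i = i0 then t *\<^sub>R b else (1 - t) *\<^sub>R a i) =
      (\<Sum>i<r. (1 - t) *\<^sub>R a i + (if i = i0 then t *\<^sub>R b else 0))"
    using assms by (intro sum.cong) auto
  also have "\<dots> = (1 - t) *\<^sub>R (\<Sum>i<r. a i) + t *\<^sub>R b"
    using assms by (simp add: sum.distrib scaleR_sum_right)
  finally show ?thesis .
qed

section \<open>Finite values of the objective\<close>

lemma factorized_objective_finite:
  assumes "\<And>i. i < r \<Longrightarrow> g (slice i X) = ereal (\<gamma> i)"
  shows "factorized_objective \<phi> g l H c r (X, Q) =
    ereal (l (factorization_map \<phi> r X, Q) + c * (\<Sum>i<r. \<gamma> i) + H Q)"
proof -
  have "(\<Sum>i<r. g (slice i X)) = ereal (\<Sum>i<r. \<gamma> i)"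
    using assms by simp
  then show ?thesis
    by (simp add: factorized_objective_def)
qed

lemma finite_objective_imp_finite_slices:
  assumes psd: "pos_semidefinite Ds g" and c: "c > 0" and X: "X \<in> factor_space Ds r"
    and fin: "factorized_objective \<phi> g l H c r (X, Q) < \<infinity>" and i: "i < r"
  shows "g (slice i X) = ereal (real_of_ereal (g (slice i X)))"
proof -
  have nonneg: "0 \<le> g (slice j X)" for j
    using psd slice_in_tuple_space[OF X] by (auto simp: pos_semidefinite_def)
  have "(\<Sum>j<r. g (slice j X)) \<noteq> \<infinity>"
    using fin c by (auto simp: factorized_objective_def)
  then have "g (slice i X) \<noteq> \<infinity>"
    using i by (auto simp: sum_Pinfty)
  then show ?thesis
    using nonneg[of i] by (cases "g (slice i X)") auto
qed

section \<open>From local to global minimality\<close>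

text \<open>
  Along the perturbation, product and regularizer are affine in \<open>t\<close>, and convexity makes \<open>H\<close> at most
  affine. So \<open>l\<close> is the only term whose increment is not linear in \<open>t\<close>, and local minimality can be
  differentiated although \<open>g\<close> and \<open>H\<close> need not be differentiable.
\<close>

lemma single_atom_optimality:
  fixes \<phi> :: "tensor_tuple \<Rightarrow> real ^ 'd" and g :: "tensor_tuple \<Rightarrow> ereal"
    and l :: "(real ^ 'd) \<times> 'e::real_normed_vector \<Rightarrow> real"
  assumes p: "0 < p" and hom_phi: "pos_homogeneous (*\<^sub>R) Ds p \<phi>"
    and hom_g: "pos_homogeneous (\<lambda>a y. ereal a * y) Ds p g"
    and H_convex: "convex_on UNIV H" and c: "c > 0"
    and loc: "local_minimizer (factorized_objective \<phi> g l H c r) (factor_space Ds r \<times> UNIV) (X, Q)"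
    and i0: "i0 < r" and zero: "slice i0 X = zero_tuple"
    and deriv: "(l has_derivative L) (at (factorization_map \<phi> r X, Q))"
    and gX: "\<And>i. i < r \<Longrightarrow> g (slice i X) = ereal (\<gamma> i)"
    and z: "z \<in> tuple_space Ds" and gz: "g z = ereal \<zeta>"
  shows "0 \<le> L (\<phi> z - factorization_map \<phi> r X, Q' - Q) + (c * (\<zeta> - (\<Sum>i<r. \<gamma> i)) + (H Q' - H Q))"
proof -
  let ?f = "factorized_objective \<phi> g l H c r"
  let ?S = "factor_space Ds r \<times> (UNIV :: 'e set)"
  let ?X = "perturbation p r X i0 z"
  define Y where "Y = factorization_map \<phi> r X"
  define G where "G = (\<Sum>i<r. \<gamma> i)"
  define Qt where "Qt = (\<lambda>t. Q + t *\<^sub>R (Q' - Q))"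
  have X: "X \<in> factor_space Ds r"
    using loc by (auto simp: local_minimizer_def)
  have "scale_tuple 0 zero_tuple = zero_tuple"
    by (auto simp: scale_tuple_def zero_tuple_def)
  then have phi0: "\<phi> zero_tuple = 0" and g0: "g zero_tuple = 0"
    using pos_homogeneous_root_scale[OF hom_phi p zero_tuple_in_tuple_space, of 0]
      pos_homogeneous_root_scale[OF hom_g p zero_tuple_in_tuple_space, of 0] p
    by (simp_all add: zero_ereal_def[symmetric])
  have map_t: "factorization_map \<phi> r (?X t) = (1 - t) *\<^sub>R Y + t *\<^sub>R \<phi> z"
    if t: "0 \<le> t" "t \<le> 1" for t
  proof -
    have "factorization_map \<phi> r (?X t) =
        (\<Sum>i<r. if i = i0 then t *\<^sub>R \<phi> z else (1 - t) *\<^sub>R \<phi> (slice i X))"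
      unfolding factorization_map_def
      by (intro sum.cong refl perturbed_slices[OF hom_phi p X z _ t]) auto
    also have "\<dots> = (1 - t) *\<^sub>R Y + t *\<^sub>R \<phi> z"
      using i0 unfolding Y_def factorization_map_def
      by (intro sum_one_slot_replaced) (auto simp: zero phi0)
    finally show ?thesis .
  qed
  have f_t: "?f (?X t, Qt t) =
      ereal (l ((1 - t) *\<^sub>R Y + t *\<^sub>R \<phi> z, Qt t) + c * ((1 - t) * G + t * \<zeta>) + H (Qt t))"
    if t: "0 \<le> t" "t \<le> 1" for t
  proof -
    have "g (slice i (?X t)) = ereal (if i = i0 then t *\<^sub>R \<zeta> else (1 - t) *\<^sub>R \<gamma> i)"
      if "i < r" for i
      using perturbed_slices[OF hom_g p X z that t] gX[OF that] gz by simp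
    then have "?f (?X t, Qt t) = ereal (l (factorization_map \<phi> r (?X t), Qt t) +
        c * (\<Sum>i<r. if i = i0 then t *\<^sub>R \<zeta> else (1 - t) *\<^sub>R \<gamma> i) + H (Qt t))"
      by (rule factorized_objective_finite)
    moreover have "\<gamma> i0 = 0"
      using gX[OF i0] by (simp add: zero g0)
    ultimately show ?thesis
      using sum_one_slot_replaced[OF i0, of \<gamma>, of t \<zeta>] map_t[OF t] by (simp add: G_def)
  qed
  have f_0: "?f (X, Q) = ereal (l (Y, Q) + c * G + H Q)"
    unfolding Y_def G_def by (rule factorized_objective_finite) (rule gX)
  have path: "((\<lambda>t. (?X t, Qt t)) \<longlongrightarrow> (X, Q)) (at_right 0)"
  proof -
    have "continuous_on {0..1} (\<lambda>t. (?X t, Qt t))"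
      unfolding Qt_def by (intro continuous_intros continuous_on_perturbation p)
    then have "((\<lambda>t. (?X t, Qt t)) \<longlongrightarrow> (?X 0, Qt 0)) (at 0 within {0..1})"
      by (auto simp: continuous_on_def)
    then show ?thesis
      by (simp add: at_within_Icc_at_right perturbation_0[OF X zero] Qt_def)
  qed
  have "\<forall>\<^sub>F y in nhds (X, Q). y \<in> ?S \<longrightarrow> ?f (X, Q) \<le> ?f y"
    using loc unfolding local_minimizer_def eventually_at_filter
    by (auto elim!: eventually_mono)
  then have "\<forall>\<^sub>F t in at_right 0. (?X t, Qt t) \<in> ?S \<longrightarrow> ?f (X, Q) \<le> ?f (?X t, Qt t)"
    using path by (rule eventually_compose_filterlim)
  then have "\<forall>\<^sub>F t in at_right 0. 0 \<le> l ((Y, Q) + t *\<^sub>R (\<phi> z - Y, Q' - Q)) - l (Y, Q) +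
      t * (c * (\<zeta> - G) + (H Q' - H Q))"
    using eventually_at_right_0_less_1
  proof eventually_elim
    case (elim t)
    then have t: "0 \<le> t" "t \<le> 1" by auto
    have "?f (X, Q) \<le> ?f (?X t, Qt t)"
      using elim perturbation_in_factor_space[OF X z] by auto
    then have "l (Y, Q) + c * G + H Q \<le>
        l ((1 - t) *\<^sub>R Y + t *\<^sub>R \<phi> z, Qt t) + c * ((1 - t) * G + t * \<zeta>) + H (Qt t)"
      unfolding f_t[OF t] f_0 by simp
    moreover have "H (Qt t) \<le> (1 - t) * H Q + t * H Q'"
    proof -
      have "H ((1 - t) *\<^sub>R Q + t *\<^sub>R Q') \<le> (1 - t) * H Q + t * H Q'"
        using t by (intro convex_onD[OF H_convex]) auto
      then show ?thesis by (simp add: Qt_def algebra_simps)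
    qed
    moreover have segment:
      "((1 - t) *\<^sub>R Y + t *\<^sub>R \<phi> z, Qt t) = (Y, Q) + t *\<^sub>R (\<phi> z - Y, Q' - Q)"
      by (simp add: Qt_def algebra_simps)
    ultimately show ?case
      unfolding segment[symmetric] by (simp add: algebra_simps)
  qed
  from directional_derivative_lower_bound[OF deriv[folded Y_def] this]
  show ?thesis by (simp add: Y_def G_def)
qed

theorem theorem15:
  fixes Ds :: "nat list list"
    and \<phi> :: "tensor_tuple \<Rightarrow> real ^ 'd"
    and g :: "tensor_tuple \<Rightarrow> ereal"
    and l :: "(real ^ 'd) \<times> 'e::real_normed_vector \<Rightarrow> real"
    and H :: "'e \<Rightarrow> real"
    and c :: real and r i0 :: nat
    and X :: tensor_tuple and Q :: 'e
  assumes fin_dim: "\<exists>B::'e set. finite B \<and> span B = UNIV"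
    and phi: "elemental_mapping Ds \<phi>"
    and g: "elemental_regularizer Ds g"
    and nondeg: "nondegenerate_pair Ds \<phi> g"
    and l_diff: "l differentiable_on UNIV"
    and l_convex: "convex_on UNIV l"
    and H_convex: "convex_on UNIV H"
    and c_pos: "c > 0"
    and attained: "\<exists>Z. global_minimizer (convex_objective Ds \<phi> g l H c) UNIV Z"
    and r: "r \<ge> 1"
    and loc: "local_minimizer (factorized_objective \<phi> g l H c r) (factor_space Ds r \<times> UNIV) (X, Q)"
    and i0: "i0 < r"
    and zero_slice: "slice i0 X = zero_tuple"
  shows "global_minimizer (factorized_objective \<phi> g l H c r) (factor_space Ds r \<times> UNIV) (X, Q)"
proof -
  let ?f = "factorized_objective \<phi> g l H c r"
  let ?S = "factor_space Ds r \<times> (UNIV :: 'e set)"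
  obtain p where "p \<noteq> 0" and hom_g: "pos_homogeneous (\<lambda>a y. ereal a * y) Ds p g"
    and hom_phi: "pos_homogeneous (*\<^sub>R) Ds p \<phi>"
    using nondeg by (auto simp: nondegenerate_pair_def)
  then have p: "0 < p" by (auto simp: pos_homogeneous_def)
  have psd: "pos_semidefinite Ds g"
    using g by (simp add: elemental_regularizer_def)
  have X: "X \<in> factor_space Ds r" and fin: "?f (X, Q) < \<infinity>"
    using loc by (auto simp: local_minimizer_def)
  define Y where "Y = factorization_map \<phi> r X"
  define \<gamma> where "\<gamma> = (\<lambda>i. real_of_ereal (g (slice i X)))"
  define G where "G = (\<Sum>i<r. \<gamma> i)"
  have gX: "g (slice i X) = ereal (\<gamma> i)" if "i < r" for i
    unfolding \<gamma>_def by (rule finite_objective_imp_finite_slices[OF psd c_pos X fin that])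
  obtain L where L: "(l has_derivative L) (at (Y, Q))"
    using l_diff by (auto simp: differentiable_on_def differentiable_def)
  have lin: "linear L"
    using L by (rule has_derivative_linear)
  have "?f (X, Q) \<le> ?f (Z, Q')" if Z: "Z \<in> factor_space Ds r" for Z Q'
  proof (cases "?f (Z, Q') < \<infinity>")
    case True
    define W where "W = factorization_map \<phi> r Z"
    define \<zeta> where "\<zeta> = (\<lambda>j. real_of_ereal (g (slice j Z)))"
    have gZ: "g (slice j Z) = ereal (\<zeta> j)" if "j < r" for j
      unfolding \<zeta>_def by (rule finite_objective_imp_finite_slices[OF psd c_pos Z True that])
    \<comment> \<open>The \<open>r\<close> slices enter by an average with weights \<open>1 / r\<close>, which the factor \<open>r\<close> undoes.\<close>
    have slot: "0 \<le> L (real r *\<^sub>R \<phi> (slice j Z) - Y, Q' - Q) +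
        (c * (real r * \<zeta> j - G) + (H Q' - H Q))" if j: "j < r" for j
    proof -
      have z: "slice j Z \<in> tuple_space Ds"
        using Z by (rule slice_in_tuple_space)
      let ?z = "scale_tuple (real r powr (1 / p)) (slice j Z)"
      have phi_z: "\<phi> ?z = real r *\<^sub>R \<phi> (slice j Z)" and g_z: "g ?z = ereal (real r * \<zeta> j)"
        using pos_homogeneous_root_scale[OF hom_phi p z, of "real r"]
          pos_homogeneous_root_scale[OF hom_g p z, of "real r"] gZ[OF j] by simp_all
      show ?thesis
        using single_atom_optimality[OF p hom_phi hom_g H_convex c_pos loc i0 zero_slice
          L[unfolded Y_def] gX scale_tuple_in_tuple_space[OF z] g_z, of Q']
        unfolding phi_z Y_def G_def by simp
    qed
    have "0 \<le> (\<Sum>j<r. L (real r *\<^sub>R \<phi> (slice j Z) - Y, Q' - Q) +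
        (c * (real r * \<zeta> j - G) + (H Q' - H Q)))"
      using slot by (intro sum_nonneg) auto
    also have "\<dots> = L (\<Sum>j<r. (real r *\<^sub>R \<phi> (slice j Z) - Y, Q' - Q)) +
        (\<Sum>j<r. c * (real r * \<zeta> j - G) + (H Q' - H Q))"
      by (simp only: sum.distrib linear_sum[OF lin])
    also have "(\<Sum>j<r. (real r *\<^sub>R \<phi> (slice j Z) - Y, Q' - Q)) = real r *\<^sub>R (W - Y, Q' - Q)"
      by (simp add: sum_prod sum_subtractf scaleR_sum_right[symmetric] W_def factorization_map_def
          scaleR_diff_right sum_constant_scaleR del: sum_constant)
    also have "L (real r *\<^sub>R (W - Y, Q' - Q)) = real r * L (W - Y, Q' - Q)"
      by (simp only: linear_scale[OF lin] real_scaleR_def)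
    also have "(\<Sum>j<r. c * (real r * \<zeta> j - G) + (H Q' - H Q)) =
        real r * (c * ((\<Sum>j<r. \<zeta> j) - G) + (H Q' - H Q))"
      by (simp add: sum.distrib sum_subtractf sum_distrib_left[symmetric] algebra_simps)
    finally have "0 \<le> real r * (L (W - Y, Q' - Q) + (c * ((\<Sum>j<r. \<zeta> j) - G) + (H Q' - H Q)))"
      by (simp only: distrib_left)
    then have "0 \<le> L (W - Y, Q' - Q) + (c * ((\<Sum>j<r. \<zeta> j) - G) + (H Q' - H Q))"
      using r by (simp add: zero_le_mult_iff)
    moreover have "l (Y, Q) + L (W - Y, Q' - Q) \<le> l (W, Q')"
      using convex_gradient_inequality[OF l_convex L, of "(W, Q')"] by simp
    ultimately have "l (Y, Q) + c * G + H Q \<le> l (W, Q') + c * (\<Sum>j<r. \<zeta> j) + H Q'"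
      by (simp add: algebra_simps)
    moreover have "?f (X, Q) = ereal (l (Y, Q) + c * G + H Q)"
      unfolding Y_def G_def by (rule factorized_objective_finite) (rule gX)
    moreover have "?f (Z, Q') = ereal (l (W, Q') + c * (\<Sum>j<r. \<zeta> j) + H Q')"
      unfolding W_def by (rule factorized_objective_finite) (rule gZ)
    ultimately show ?thesis by simp
  qed simp
  then show ?thesis
    using X fin by (auto simp: global_minimizer_def)
qed

end
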